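(* Consider a centralized surface (C-LIS) system with a single circular surface $\mathcal{S}$ of radius $R>0$ serving $K$ users with matched filtering. Then the achievable spectral efficiency of the $k$th user, $k=1,\dots,K$, is $$\mathsf{R}_k=\log_2\left(1+\frac{p_k\,\mathrm{PL}_k}{\frac{1}{\pi R^2}\sigma^2+\sum_{k'\ne k}p_{k'}\,\mathrm{PL}_{k'}\,\tilde{\rm B}(R,\kappa,\chi_{kk'})^2}\right),$$ where $\tilde{\rm B}(R,\kappa,\chi_{kk'})=\dfrac{{\rm B}(R,\kappa,\chi_{kk'})}{{\rm B}(R,\kappa,\chi_{kk})}$, and the overall sum spectral efficiency across the $K$ users equals $\mathsf{R}^{\text{C-LIS}}_{\text{total}}=\sum_{k=1}^K\mathsf{R}_k$.
   Context: $j$ is the imaginary unit, $^*$ denotes complex conjugation, $J_1$ is the Bessel function of the first kind of order $1$. The surface occupies $\mathcal{S}=\{(x,y): x^2+y^2\le R^2\}$ in the $xy$-plane. User $k$ is at $(x_k,y_k,z_k)\in\mathbb{R}^3$ with $z_k>0$; $d_k^c=\sqrt{x_k^2+y_k^2+z_k^2}$; $p_k$ is the (nonnegative) transmit power of user $k$; $\sigma^2>0$ is the noise variance; $\kappa=2\pi/\lambda$ with $\lambda>0$ the wavelength; $\varphi_k\in[-\pi,\pi]$ is a phase of user $k$; $\mathrm{PL}_k=\left(\frac{1}{2\kappa d_k^c}\right)^2$ is the path loss. In the far-field (plane-wave) model the channel response of user $k$ at $(x,y,0)$ is $$h_k(x,y)=\exp\!\Big(-j\Big(\kappa d_k^c+\kappa\,\frac{y_k\,y-x_k\,x}{d_k^c}+\varphi_k\Big)\Big),$$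 and the effective channel is $\Sigma^{\mathcal{S}}_{kk'}=\iint_{\mathcal{S}}h_k^*(x,y)h_{k'}(x,y)\,dx\,dy$. The achievable spectral efficiency of user $k$ with matched filtering is by definition $$\mathsf{R}_k=\log_2\left(1+\frac{p_k\,\mathrm{PL}_k\,(\Sigma^{\mathcal{S}}_{kk})^2}{\Sigma^{\mathcal{S}}_{kk}\sigma^2+\sum_{k'\ne k}p_{k'}\,\mathrm{PL}_{k'}\,|\Sigma^{\mathcal{S}}_{kk'}|^2}\right),$$ and the sum spectral efficiency is the sum of these over all users. Put $\eta_{kk'}=\frac{x_k}{d_k^c}-\frac{x_{k'}}{d_{k'}^c}$, $\xi_{kk'}=\frac{y_k}{d_k^c}-\frac{y_{k'}}{d_{k'}^c}$, $\chi_{kk'}=\sqrt{\eta_{kk'}^2+\xi_{kk'}^2}\ge 0$, and ${\rm B}(R,\kappa,\chi)=2\pi R\,\frac{J_1(R\kappa\chi)}{\kappa\chi}$, understood as its limit $\pi R^2$ when $\chi=0$ (in particular ${\rm B}(R,\kappa,\chi_{kk})=\pi R^2$). *)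

theory Defs
  imports "HOL-Analysis.Analysis"
begin

definition bessel_J :: "nat \<Rightarrow> real \<Rightarrow> real" where
  "bessel_J n x = (\<Sum>m. (-1) ^ m / (fact m * fact (m + n)) * (x / 2) ^ (2 * m + n))"

lemma bessel_J_sums:
  "(\<lambda>m. (-1) ^ m / (fact m * fact (m + n)) * (x / 2) ^ (2 * m + n)) sums bessel_J n x"
proof -
  let ?f = "\<lambda>m. (-1) ^ m / (fact m * fact (m + n)) * (x / 2) ^ (2 * m + n)"
  let ?g = "\<lambda>m. \<bar>x / 2\<bar> ^ n * (inverse (fact m) * ((x / 2)\<^sup>2) ^ m)"
  have "summable ?g"
    by (intro summable_mult summable_exp)
  moreover have "norm (?f m) \<le> ?g m" for m
  proof -
    have "\<bar>(x / 2) ^ (2 * m + n)\<bar> = ((x / 2)\<^sup>2) ^ m * \<bar>x / 2\<bar> ^ n"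
      by (simp only: power_add power_mult abs_mult power_abs power2_abs)
    moreover have "\<bar>(-1) ^ m / (fact m * fact (m + n))\<bar>
        = inverse (fact m) * (inverse (fact (m + n)) :: real)"
      by (simp add: abs_mult power_abs divide_inverse)
    ultimately have "norm (?f m) =
        (inverse (fact m) * ((x / 2)\<^sup>2) ^ m * \<bar>x / 2\<bar> ^ n) * inverse (fact (m + n))"
      by (simp only: real_norm_def abs_mult mult_ac)
    also have "\<dots> \<le> (inverse (fact m) * ((x / 2)\<^sup>2) ^ m * \<bar>x / 2\<bar> ^ n) * 1"
      by (intro mult_left_mono) (auto simp: inverse_le_1_iff fact_ge_1)
    finally show ?thesis by (simp only: mult_ac mult_1_right)
  qed
  ultimately have "summable ?f"
    by (rule summable_comparison_test'[where N = 0])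
  then show ?thesis
    unfolding bessel_J_def by (rule summable_sums)
qed

record user =
  xpos :: real
  ypos :: real
  zpos :: real
  tx_power :: real
  phase :: real

definition wavenumber :: "real \<Rightarrow> real" where
  "wavenumber wl = 2 * pi / wl"

definition centre_dist :: "user \<Rightarrow> real" where
  "centre_dist v = sqrt ((xpos v)\<^sup>2 + (ypos v)\<^sup>2 + (zpos v)\<^sup>2)"

definition path_loss :: "real \<Rightarrow> user \<Rightarrow> real" where
  "path_loss \<kappa> v = (1 / (2 * \<kappa> * centre_dist v))\<^sup>2"

definition disc :: "real \<Rightarrow> (real \<times> real) set" where
  "disc R = {(x, y). x\<^sup>2 + y\<^sup>2 \<le> R\<^sup>2}"

definition channel_response :: "real \<Rightarrow> user \<Rightarrow> real \<Rightarrow> real \<Rightarrow> complex" where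
  "channel_response \<kappa> v x y =
     exp (- \<i> * complex_of_real
       (\<kappa> * centre_dist v + \<kappa> * ((ypos v * y - xpos v * x) / centre_dist v) + phase v))"

definition effective_channel ::
    "(real \<times> real) set \<Rightarrow> real \<Rightarrow> user \<Rightarrow> user \<Rightarrow> complex" where
  "effective_channel S \<kappa> v w =
     (LINT q:S|lborel. (case q of (x, y) \<Rightarrow>
        cnj (channel_response \<kappa> v x y) * channel_response \<kappa> w x y))"

lemma effective_channel_integrable:
  "set_integrable lborel (disc R)
     (\<lambda>q. case q of (x, y) \<Rightarrow> cnj (channel_response \<kappa> v x y) * channel_response \<kappa> w x y)"
  unfolding set_integrable_def
proof (rule borel_integrable_compact)
  have "sqrt (x\<^sup>2 + y\<^sup>2) \<le> \<bar>R\<bar> \<longleftrightarrow> x\<^sup>2 + y\<^sup>2 \<le> R\<^sup>2" for x y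
    by (metis real_sqrt_abs real_sqrt_le_iff)
  then have "disc R = cball 0 \<bar>R\<bar>"
    by (auto simp: disc_def norm_prod_def)
  then show "compact (disc R)" by simp
  show "continuous_on (disc R)
     (\<lambda>q. case q of (x, y) \<Rightarrow> cnj (channel_response \<kappa> v x y) * channel_response \<kappa> w x y)"
    unfolding channel_response_def case_prod_beta divide_inverse
    by (intro continuous_intros)
qed

lemma effective_channel_self_real: "effective_channel S \<kappa> v v \<in> \<real>"
proof -
  have "cnj (channel_response \<kappa> v x y) * channel_response \<kappa> v x y = complex_of_real 1" for x y
    by (simp add: channel_response_def exp_cnj mult_exp_exp)
  then have "effective_channel S \<kappa> v v = (LINT q:S|lborel. complex_of_real 1)"
    unfolding effective_channel_def by (simp only: case_prod_unfold)
  also have "\<dots> = complex_of_real (LINT q:S|lborel. 1)"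
    by (rule set_integral_complex_of_real)
  finally show ?thesis by simp
qed

text \<open>Spectral efficiency of user \<open>k\<close> under matched filtering. The diagonal effective channel
  is a real number (see the lemma above), so \<^const>\<open>Re\<close> only changes its type.\<close>

definition spectral_efficiency ::
    "(real \<times> real) set \<Rightarrow> real \<Rightarrow> real \<Rightarrow> nat \<Rightarrow> (nat \<Rightarrow> user) \<Rightarrow> nat \<Rightarrow> real" where
  "spectral_efficiency S \<kappa> \<sigma> K u k =
     log 2 (1 +
       tx_power (u k) * path_loss \<kappa> (u k) * (Re (effective_channel S \<kappa> (u k) (u k)))\<^sup>2 /
       (Re (effective_channel S \<kappa> (u k) (u k)) * \<sigma>\<^sup>2 +
        (\<Sum>k'\<in>{1..K} - {k}. tx_power (u k') * path_loss \<kappa> (u k') *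
           (cmod (effective_channel S \<kappa> (u k) (u k')))\<^sup>2)))"

definition sum_spectral_efficiency ::
    "(real \<times> real) set \<Rightarrow> real \<Rightarrow> real \<Rightarrow> nat \<Rightarrow> (nat \<Rightarrow> user) \<Rightarrow> real" where
  "sum_spectral_efficiency S \<kappa> \<sigma> K u = (\<Sum>k=1..K. spectral_efficiency S \<kappa> \<sigma> K u k)"

definition eta :: "user \<Rightarrow> user \<Rightarrow> real" where
  "eta v w = xpos v / centre_dist v - xpos w / centre_dist w"

definition xi :: "user \<Rightarrow> user \<Rightarrow> real" where
  "xi v w = ypos v / centre_dist v - ypos w / centre_dist w"

definition chi :: "user \<Rightarrow> user \<Rightarrow> real" where
  "chi v w = sqrt ((eta v w)\<^sup>2 + (xi v w)\<^sup>2)"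

definition B_fun :: "real \<Rightarrow> real \<Rightarrow> real \<Rightarrow> real" where
  "B_fun R \<kappa> c = (if c = 0 then pi * R\<^sup>2 else 2 * pi * R * (bessel_J 1 (R * \<kappa> * c) / (\<kappa> * c)))"

text \<open>The value at \<open>0\<close> is the limit of the formula used elsewhere.\<close>

lemma B_fun_tendsto_0:
  assumes "\<kappa> \<noteq> 0"
  shows "((\<lambda>c. 2 * pi * R * (bessel_J 1 (R * \<kappa> * c) / (\<kappa> * c))) \<longlongrightarrow> B_fun R \<kappa> 0) (at 0)"
proof -
  define a :: "nat \<Rightarrow> real" where "a m = (-1) ^ m / (fact m * fact (m + 1))" for m
  define g where "g t = (\<Sum>m. a m * t ^ m)" for t :: real
  have sm: "summable (\<lambda>m. a m * t ^ m)" for t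
  proof (rule summable_comparison_test'[where N = 0])
    show "summable (\<lambda>m. inverse (fact m) * \<bar>t\<bar> ^ m)" by (rule summable_exp)
    show "norm (a m * t ^ m) \<le> inverse (fact m) * \<bar>t\<bar> ^ m" for m
    proof -
      have "norm (a m * t ^ m) = (inverse (fact m) * \<bar>t\<bar> ^ m) * inverse (fact (m + 1))"
        by (simp add: a_def abs_mult power_abs divide_inverse del: fact_Suc)
      also have "\<dots> \<le> (inverse (fact m) * \<bar>t\<bar> ^ m) * 1"
        by (intro mult_left_mono) (auto simp: inverse_le_1_iff fact_ge_1 simp del: fact_Suc)
      finally show ?thesis by simp
    qed
  qed
  have J: "bessel_J 1 s = s / 2 * g ((s / 2)\<^sup>2)" for s
  proof -
    have "(\<lambda>m. s / 2 * (a m * ((s / 2)\<^sup>2) ^ m)) sums (s / 2 * g ((s / 2)\<^sup>2))"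
      unfolding g_def by (intro sums_mult summable_sums sm)
    moreover have "s / 2 * (a m * ((s / 2)\<^sup>2) ^ m)
        = (-1) ^ m / (fact m * fact (m + 1)) * (s / 2) ^ (2 * m + 1)" for m
      by (simp add: a_def power_mult del: fact_Suc) (simp only: mult_ac)
    ultimately have "(\<lambda>m. (-1) ^ m / (fact m * fact (m + 1)) * (s / 2) ^ (2 * m + 1))
        sums (s / 2 * g ((s / 2)\<^sup>2))"
      by (simp only:)
    then show ?thesis
      by (rule sums_unique2[OF bessel_J_sums])
  qed
  have "isCont g 0"
    unfolding g_def by (rule isCont_powser[OF sm[of 1]]) simp
  moreover have "((\<lambda>c. (R * \<kappa> * c / 2)\<^sup>2) \<longlongrightarrow> 0) (at 0)"
    by (auto intro!: tendsto_eq_intros)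
  ultimately have "((\<lambda>c. g ((R * \<kappa> * c / 2)\<^sup>2)) \<longlongrightarrow> g 0) (at 0)"
    by (rule isCont_tendsto_compose)
  moreover have "g 0 = 1"
    unfolding g_def powser_zero by (simp add: a_def)
  ultimately have "((\<lambda>c. pi * R\<^sup>2 * g ((R * \<kappa> * c / 2)\<^sup>2)) \<longlongrightarrow> pi * R\<^sup>2 * 1) (at 0)"
    by (intro tendsto_mult_left) simp
  moreover have "pi * R\<^sup>2 * g ((R * \<kappa> * c / 2)\<^sup>2)
      = 2 * pi * R * (bessel_J 1 (R * \<kappa> * c) / (\<kappa> * c))" if "c \<noteq> 0" for c
    unfolding J power2_eq_square[of R] using assms that by simp
  then have "\<forall>\<^sub>F c in at 0. pi * R\<^sup>2 * g ((R * \<kappa> * c / 2)\<^sup>2)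
      = 2 * pi * R * (bessel_J 1 (R * \<kappa> * c) / (\<kappa> * c))"
    by (simp add: eventually_at_filter)
  ultimately have "((\<lambda>c. 2 * pi * R * (bessel_J 1 (R * \<kappa> * c) / (\<kappa> * c)))
      \<longlongrightarrow> pi * R\<^sup>2 * 1) (at 0)"
    by (rule Lim_transform_eventually)
  then show ?thesis
    by (simp add: B_fun_def)
qed

definition B_normalized :: "real \<Rightarrow> real \<Rightarrow> user \<Rightarrow> user \<Rightarrow> real" where
  "B_normalized R \<kappa> v w = B_fun R \<kappa> (chi v w) / B_fun R \<kappa> (chi v v)"

end

theory Submission
  imports Defs
begin

text \<open>
  Up to a unit phase, the effective channel is the Fourier transform of the disc at a
  wave vector of length \<open>\<kappa> \<chi>\<close>. Lebesgue measure is rotation invariant, so the wave vector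
  may be taken along the first axis. Expanding the cosine then reduces the claim to the
  even moments of the disc, and summing the moments yields the series of \<open>J\<^sub>1\<close>.
  The spectral efficiency follows on dividing by \<open>(\<pi> R\<^sup>2)\<^sup>2\<close>.
\<close>

section \<open>Shears, rotations and the invariance of Lebesgue measure\<close>

definition shear_x :: "real \<Rightarrow> real \<times> real \<Rightarrow> real \<times> real" where
  "shear_x t q = (fst q + t * snd q, snd q)"

definition shear_y :: "real \<Rightarrow> real \<times> real \<Rightarrow> real \<times> real" where
  "shear_y t q = (fst q, snd q + t * fst q)"

text \<open>For \<open>a = cos \<theta>\<close> and \<open>b = sin \<theta>\<close> this is the
  clockwise turn by \<open>\<theta>\<close>. It carries the unit vector \<open>(a, b)\<close> to
  \<open>(1, 0)\<close>, the form needed to align a wave vector with the first axis.\<close>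

definition plane_rotation :: "real \<Rightarrow> real \<Rightarrow> real \<times> real \<Rightarrow> real \<times> real" where
  "plane_rotation a b q = (a * fst q + b * snd q, a * snd q - b * fst q)"

lemma measurable_shear_x [measurable]: "shear_x t \<in> borel_measurable borel"
  unfolding shear_x_def by (intro borel_measurable_continuous_onI continuous_intros)

lemma measurable_shear_y [measurable]: "shear_y t \<in> borel_measurable borel"
  unfolding shear_y_def by (intro borel_measurable_continuous_onI continuous_intros)

lemma measurable_plane_rotation [measurable]: "plane_rotation a b \<in> borel_measurable borel"
  unfolding plane_rotation_def by (intro borel_measurable_continuous_onI continuous_intros)

lemma nn_integral_lborel_translate:
  fixes f :: "real \<Rightarrow> ennreal"
  assumes "f \<in> borel_measurable borel"
  shows "(\<integral>\<^sup>+x. f (x + t) \<partial>lborel) = (\<integral>\<^sup>+x. f x \<partial>lborel)"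
  using nn_integral_real_affine[OF assms, of 1 t] by (simp add: add.commute)

text \<open>By Fubini each horizontal line can be treated alone. On the line at height
  \<open>y\<close> the shear is the translation by \<open>t * y\<close>, which preserves
  one-dimensional Lebesgue measure.\<close>

lemma distr_lborel_shear_x: "distr lborel borel (shear_x t) = lborel"
proof (rule measure_eqI)
  fix A :: "(real \<times> real) set" assume "A \<in> sets (distr lborel borel (shear_x t))"
  then have A [measurable]: "A \<in> sets borel" by simp
  have AA: "A \<in> sets (lborel \<Otimes>\<^sub>M lborel)" unfolding lborel_prod by simp
  have ind: "(indicator A :: real \<times> real \<Rightarrow> ennreal) \<in> borel_measurable (lborel \<Otimes>\<^sub>M lborel)"
    using AA by simp
  have ind_shear: "(\<lambda>q. indicator A (shear_x t q) :: ennreal)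
      \<in> borel_measurable (lborel \<Otimes>\<^sub>M lborel)"
    by (simp add: lborel_prod)
  have "emeasure (distr lborel borel (shear_x t)) A =
      (\<integral>\<^sup>+q. indicator A q \<partial>distr lborel borel (shear_x t))"
    by simp
  also have "\<dots> = (\<integral>\<^sup>+q. indicator A (shear_x t q) \<partial>lborel)"
    by (rule nn_integral_distr) simp_all
  also have "\<dots> = (\<integral>\<^sup>+y. \<integral>\<^sup>+x. indicator A (x + t * y, y) \<partial>lborel \<partial>lborel)"
    using lborel_pair.nn_integral_snd[OF ind_shear[unfolded case_prod_beta]]
    by (simp add: lborel_prod shear_x_def)
  also have "\<dots> = (\<integral>\<^sup>+y. \<integral>\<^sup>+x. indicator A (x, y) \<partial>lborel \<partial>lborel)"
  proof (rule nn_integral_cong, rule nn_integral_lborel_translate)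
    fix y :: real
    have "(\<lambda>x. (x, y)) \<in> borel_measurable borel"
      by (intro borel_measurable_continuous_onI continuous_intros)
    then show "(\<lambda>x. indicator A (x, y) :: ennreal) \<in> borel_measurable borel"
      by measurable
  qed
  also have "\<dots> = emeasure lborel A"
    using lborel_pair.nn_integral_snd[OF ind] by (simp add: lborel_prod)
  finally show "emeasure (distr lborel borel (shear_x t)) A = emeasure lborel A" .
qed simp

lemma distr_lborel_shear_y: "distr lborel borel (shear_y t) = lborel"
proof (rule measure_eqI)
  fix A :: "(real \<times> real) set" assume "A \<in> sets (distr lborel borel (shear_y t))"
  then have A [measurable]: "A \<in> sets borel" by simp
  have AA: "A \<in> sets (lborel \<Otimes>\<^sub>M lborel)" unfolding lborel_prod by simp
  have ind: "(indicator A :: real \<times> real \<Rightarrow> ennreal) \<in> borel_measurable (lborel \<Otimes>\<^sub>M lborel)"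
    using AA by simp
  have ind_shear: "(\<lambda>q. indicator A (shear_y t q) :: ennreal)
      \<in> borel_measurable (lborel \<Otimes>\<^sub>M lborel)"
    by (simp add: lborel_prod)
  have "emeasure (distr lborel borel (shear_y t)) A =
      (\<integral>\<^sup>+q. indicator A q \<partial>distr lborel borel (shear_y t))"
    by simp
  also have "\<dots> = (\<integral>\<^sup>+q. indicator A (shear_y t q) \<partial>lborel)"
    by (rule nn_integral_distr) simp_all
  also have "\<dots> = (\<integral>\<^sup>+x. \<integral>\<^sup>+y. indicator A (x, y + t * x) \<partial>lborel \<partial>lborel)"
    using lborel.nn_integral_fst[OF ind_shear]
    by (simp add: lborel_prod shear_y_def)
  also have "\<dots> = (\<integral>\<^sup>+x. \<integral>\<^sup>+y. indicator A (x, y) \<partial>lborel \<partial>lborel)"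
  proof (rule nn_integral_cong, rule nn_integral_lborel_translate)
    fix x :: real
    have "(\<lambda>y. (x, y)) \<in> borel_measurable borel"
      by (intro borel_measurable_continuous_onI continuous_intros)
    then show "(\<lambda>y. indicator A (x, y) :: ennreal) \<in> borel_measurable borel"
      by measurable
  qed
  also have "\<dots> = emeasure lborel A"
    using lborel.nn_integral_fst[OF ind] by (simp add: lborel_prod)
  finally show "emeasure (distr lborel borel (shear_y t)) A = emeasure lborel A" .
qed simp

lemma distr_lborel_comp:
  fixes f g :: "'a::euclidean_space \<Rightarrow> 'a"
  assumes [measurable]: "f \<in> borel_measurable borel" "g \<in> borel_measurable borel"
    and "distr lborel borel f = lborel" "distr lborel borel g = lborel"
  shows "distr lborel borel (f \<circ> g) = lborel"
proof -
  have "distr lborel borel (f \<circ> g) = distr (distr lborel borel g) borel f"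
    by (rule distr_distr[symmetric]) simp_all
  then show ?thesis using assms by simp
qed

lemma distr_lborel_plane_rotation:
  assumes "a\<^sup>2 + b\<^sup>2 = 1"
  shows "distr lborel borel (plane_rotation a b) = lborel"
proof -
  \<comment> \<open>For \<open>a = cos \<theta>\<close>, \<open>b = sin \<theta>\<close> the map is a product of three shears, with parameters \<open>tan (\<theta>/2)\<close>, \<open>-sin \<theta>\<close>,
    \<open>tan (\<theta>/2)\<close>. This breaks down only at the half turn, a product of two quarter turns.\<close>
  have main: "distr lborel borel (plane_rotation a b) = lborel"
    if ab: "a\<^sup>2 + b\<^sup>2 = 1" and "a \<noteq> -1" for a b
  proof -
    \<comment> \<open>The half-angle formula tan(\<theta>/2) = sin \<theta> / (1 + cos \<theta>),
      written without the angle.\<close>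
    define p where "p = b / (1 + a)"
    have "1 + a \<noteq> 0" using that by (metis add_eq_0_iff)
    moreover have "b * b = (1 - a) * (1 + a)"
      using ab by (simp add: algebra_simps power2_eq_square)
    ultimately have pb: "p * b = 1 - a" and pa: "p * (1 + a) = b"
      by (simp_all add: p_def)
    have "(shear_x p \<circ> (shear_y (- b) \<circ> shear_x p)) (x, y) = plane_rotation a b (x, y)" for x y
    proof -
      have "x + p * y + p * (y - b * (x + p * y)) = (1 - p * b) * x + p * (2 - p * b) * y"
        by (simp add: algebra_simps)
      also have "\<dots> = a * x + p * (1 + a) * y"
        by (simp add: pb)
      also have "\<dots> = a * x + b * y"
        by (simp only: pa)
      finally have 1: "x + p * y + p * (y - b * (x + p * y)) = a * x + b * y" .
      have "y - b * (x + p * y) = (1 - p * b) * y - b * x"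
        by (simp add: algebra_simps)
      then have 2: "y - b * (x + p * y) = a * y - b * x" by (simp add: pb)
      show ?thesis using 1 2 by (simp add: shear_x_def shear_y_def plane_rotation_def)
    qed
    then have "plane_rotation a b = shear_x p \<circ> (shear_y (- b) \<circ> shear_x p)"
      by (metis (no_types, lifting) ext surj_pair)
    then show ?thesis
      by (simp only:) (intro distr_lborel_comp distr_lborel_shear_x distr_lborel_shear_y
        measurable_shear_x measurable_shear_y
        measurable_comp[OF measurable_shear_x measurable_shear_y])
  qed
  show ?thesis
  proof (cases "a = -1")
    case True
    then have "plane_rotation a b = plane_rotation 0 1 \<circ> plane_rotation 0 1"
      using assms by (auto simp: plane_rotation_def fun_eq_iff)
    then show ?thesis
      by (simp only:) (intro distr_lborel_comp main measurable_plane_rotation; simp)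
  qed (use assms main in simp)
qed

section \<open>Integration over the disc\<close>

lemma plane_rotation_in_disc:
  assumes "a\<^sup>2 + b\<^sup>2 = 1"
  shows "plane_rotation a b q \<in> disc R \<longleftrightarrow> q \<in> disc R"
proof -
  have "(a * x + b * y)\<^sup>2 + (a * y - b * x)\<^sup>2 = (a\<^sup>2 + b\<^sup>2) * (x\<^sup>2 + y\<^sup>2)" for x y
    by (simp add: algebra_simps power2_eq_square)
  then show ?thesis by (cases q) (simp add: disc_def plane_rotation_def assms)
qed

text \<open>The norm on pairs of reals is Euclidean. As a ball, the disc inherits compactness and a
  known area.\<close>

lemma disc_eq_cball:
  assumes "R \<ge> 0"
  shows "disc R = cball 0 R"
proof -
  have "sqrt (x\<^sup>2 + y\<^sup>2) \<le> R \<longleftrightarrow> x\<^sup>2 + y\<^sup>2 \<le> R\<^sup>2" for x y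
    using assms by (metis abs_of_nonneg real_sqrt_abs real_sqrt_le_iff)
  then show ?thesis by (auto simp: disc_def norm_prod_def)
qed

lemma disc_measurable [measurable]: "disc R \<in> sets borel"
proof -
  have "disc R = disc \<bar>R\<bar>" by (simp add: disc_def)
  then show ?thesis by (simp add: disc_eq_cball)
qed

text \<open>A change of variables along a map that preserves both Lebesgue measure and the
  disc.\<close>

lemma set_integral_disc_plane_rotation:
  fixes f :: "real \<times> real \<Rightarrow> real"
  assumes "a\<^sup>2 + b\<^sup>2 = 1" and [measurable]: "f \<in> borel_measurable borel"
  shows "(LINT q:disc R|lborel. f (plane_rotation a b q)) = (LINT q:disc R|lborel. f q)"
proof -
  have "(LINT q:disc R|lborel. f q) =
      (LINT q|distr lborel borel (plane_rotation a b). indicator (disc R) q *\<^sub>R f q)"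
    by (simp add: distr_lborel_plane_rotation[OF assms(1)] set_lebesgue_integral_def)
  also have "\<dots> = (LINT q|lborel. indicator (disc R) (plane_rotation a b q) *\<^sub>R f (plane_rotation a b q))"
    by (rule integral_distr) simp_all
  finally show ?thesis
    by (simp add: set_lebesgue_integral_def indicator_def plane_rotation_in_disc[OF assms(1)])
qed

lemma set_integrable_disc:
  fixes f :: "real \<times> real \<Rightarrow> 'b::euclidean_space"
  assumes "R \<ge> 0" "continuous_on UNIV f"
  shows "set_integrable lborel (disc R) f"
  unfolding set_integrable_def disc_eq_cball[OF assms(1)]
  by (intro borel_integrable_compact continuous_on_subset[OF assms(2)]) auto


section \<open>Even moments of the disc\<close>

text \<open>Integration by parts in disguise: the two sides differ by the integral of the derivative
  of \<open>F\<close>, and \<open>F\<close> vanishes at both endpoints.\<close>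

lemma semicircle_moment_rec:
  assumes "R > 0"
  shows "real (n + 4) * integral {-R..R} (\<lambda>x. x ^ (n + 2) * sqrt (R\<^sup>2 - x\<^sup>2)) =
    real (n + 1) * R\<^sup>2 * integral {-R..R} (\<lambda>x. x ^ n * sqrt (R\<^sup>2 - x\<^sup>2))"
proof -
  \<comment> \<open>This is x^(n+1) (R^2 - x^2)^(3/2) on the interval. Its derivative combines
    exactly the moments of orders \<open>n\<close> and \<open>n + 2\<close>.\<close>
  define F where "F x = x ^ (n + 1) * (R\<^sup>2 - x\<^sup>2) * sqrt (R\<^sup>2 - x\<^sup>2)" for x
  define F' where "F' x = real (n + 1) * R\<^sup>2 * (x ^ n * sqrt (R\<^sup>2 - x\<^sup>2))
      - real (n + 4) * (x ^ (n + 2) * sqrt (R\<^sup>2 - x\<^sup>2))" for x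
  have int: "(\<lambda>x. x ^ k * sqrt (R\<^sup>2 - x\<^sup>2)) integrable_on {-R..R}" for k
    by (intro integrable_continuous_real continuous_intros)
  have "(F' has_integral F R - F (- R)) {-R..R}"
  \<comment> \<open>The chain rule through \<open>sqrt\<close> applies only where
    \<open>R\<^sup>2 - x\<^sup>2\<close> is positive, so the derivative is taken in the open
    interval and continuity covers the endpoints.\<close>
  proof (rule fundamental_theorem_of_calculus_interior)
    show "continuous_on {-R..R} F"
      unfolding F_def by (intro continuous_intros)
    show "(F has_vector_derivative F' x) (at x)" if "x \<in> {-R<..<R}" for x
    proof -
      define s where "s = sqrt (R\<^sup>2 - x\<^sup>2)"
      have "\<bar>x\<bar> < \<bar>R\<bar>" using that assms by auto
      then have pos: "R\<^sup>2 - x\<^sup>2 > 0"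
        using power_strict_mono[of "\<bar>x\<bar>" "\<bar>R\<bar>" 2] by simp
      then have s: "s > 0" "R\<^sup>2 - x\<^sup>2 = s * s" by (simp_all add: s_def)
      have ds: "((\<lambda>x. sqrt (R\<^sup>2 - x\<^sup>2)) has_real_derivative (- x / s)) (at x)"
        unfolding s_def using pos
        by (auto intro!: derivative_eq_intros simp: field_simps)
      have "(F has_real_derivative
          (real (n + 1) * x ^ n * (R\<^sup>2 - x\<^sup>2) + x ^ (n + 1) * (- 2 * x)) * s
            + x ^ (n + 1) * (R\<^sup>2 - x\<^sup>2) * (- x / s)) (at x)"
        unfolding F_def s_def
        by (rule derivative_eq_intros ds[unfolded s_def] refl)+ (simp add: algebra_simps)
      moreover have "(real (n + 1) * x ^ n * (R\<^sup>2 - x\<^sup>2) + x ^ (n + 1) * (- 2 * x)) * s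
            + x ^ (n + 1) * (R\<^sup>2 - x\<^sup>2) * (- x / s) = F' x"
      proof -
        have "x ^ (n + 1) * (R\<^sup>2 - x\<^sup>2) * (- x / s) = - (x ^ (n + 2) * s)"
          using s by simp
        then show ?thesis
          unfolding F'_def s_def[symmetric]
          by (simp add: algebra_simps power2_eq_square)
      qed
      ultimately show ?thesis
        by (simp add: has_real_derivative_iff_has_vector_derivative)
    qed
  qed (use assms in simp)
  moreover have "F R = 0" "F (- R) = 0" by (simp_all add: F_def)
  ultimately have "integral {-R..R} F' = 0"
    using integral_unique by force
  moreover have "integral {-R..R} F' =
      real (n + 1) * R\<^sup>2 * integral {-R..R} (\<lambda>x. x ^ n * sqrt (R\<^sup>2 - x\<^sup>2))
      - real (n + 4) * integral {-R..R} (\<lambda>x. x ^ (n + 2) * sqrt (R\<^sup>2 - x\<^sup>2))"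
    unfolding F'_def
    by (subst integral_diff) (intro integrable_on_mult_right int integral_mult_right
      arg_cong2[where f = "(-)"])+
  ultimately show ?thesis by simp
qed

text \<open>By Fubini: the vertical slice of the disc at \<open>x\<close> is an interval of
  half-length \<open>sqrt (R\<^sup>2 - x\<^sup>2)\<close>, on which the integrand is
  constant.\<close>

lemma disc_moment_eq_semicircle_moment:
  assumes "R > 0"
  shows "(LINT q:disc R|lborel. fst q ^ n) =
    2 * integral {-R..R} (\<lambda>x. x ^ n * sqrt (R\<^sup>2 - x\<^sup>2))"
proof -
  let ?f = "\<lambda>q :: real \<times> real. indicator (disc R) q *\<^sub>R fst q ^ n"
  have "set_integrable lborel (disc R) (\<lambda>q. fst q ^ n)"
    using assms by (intro set_integrable_disc continuous_intros) simp
  then have "integrable (lborel \<Otimes>\<^sub>M lborel) ?f"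
    by (simp add: lborel_prod set_integrable_def)
  from lborel_pair.integral_fst'[OF this]
  have "(LINT q:disc R|lborel. fst q ^ n) =
      (LINT x|lborel. LINT y|lborel. indicator (disc R) (x, y) *\<^sub>R x ^ n)"
    by (simp add: lborel_prod set_lebesgue_integral_def)
  also have "\<dots> = (LINT x:{-R..R}|lborel. 2 * (x ^ n * sqrt (R\<^sup>2 - x\<^sup>2)))"
    unfolding set_lebesgue_integral_def
  proof (rule Bochner_Integration.integral_cong[OF refl])
    fix x :: real
    show "(LINT y|lborel. indicator (disc R) (x, y) *\<^sub>R x ^ n) =
        indicator {-R..R} x *\<^sub>R (2 * (x ^ n * sqrt (R\<^sup>2 - x\<^sup>2)))"
    proof (cases "x \<in> {-R..R}")
      case True
      then have "x\<^sup>2 \<le> R\<^sup>2" using assms by (simp add: abs_le_square_iff[symmetric] abs_le_iff)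
      define s where "s = sqrt (R\<^sup>2 - x\<^sup>2)"
      have s: "s \<ge> 0" "s\<^sup>2 = R\<^sup>2 - x\<^sup>2" using \<open>x\<^sup>2 \<le> R\<^sup>2\<close> by (simp_all add: s_def)
      have "x\<^sup>2 + y\<^sup>2 \<le> R\<^sup>2 \<longleftrightarrow> y \<in> {-s..s}" for y
      proof -
        have "x\<^sup>2 + y\<^sup>2 \<le> R\<^sup>2 \<longleftrightarrow> y\<^sup>2 \<le> s\<^sup>2" using s by auto
        also have "\<dots> \<longleftrightarrow> \<bar>y\<bar> \<le> s" using s(1) by (metis abs_le_square_iff abs_of_nonneg)
        finally show ?thesis by auto
      qed
      then have "(\<lambda>y. indicator (disc R) (x, y) *\<^sub>R x ^ n) = (\<lambda>y. indicator {-s..s} y *\<^sub>R x ^ n)"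
        by (auto simp: disc_def indicator_def fun_eq_iff)
      then show ?thesis using True s(1) by (simp add: s_def)
    next
      \<comment> \<open>Here the slice is empty. The indicator on the right is essential, since
        \<open>sqrt\<close> of a negative number is negative and not 0.\<close>
      case False
      then have "R\<^sup>2 < x\<^sup>2" using assms by (auto simp: abs_le_square_iff[symmetric] not_le[symmetric])
      then have "\<not> x\<^sup>2 + y\<^sup>2 \<le> R\<^sup>2" for y using zero_le_power2[of y] by linarith
      then have "(x, y) \<notin> disc R" for y by (simp add: disc_def)
      then show ?thesis using False by simp
    qed
  qed
  also have "\<dots> = integral {-R..R} (\<lambda>x. 2 * (x ^ n * sqrt (R\<^sup>2 - x\<^sup>2)))"
    by (rule set_borel_integral_eq_integral)
      (unfold set_integrable_def, intro borel_integrable_compact continuous_intros compact_Icc)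
  finally show ?thesis by simp
qed

lemma disc_moment_0:
  assumes "R \<ge> 0"
  shows "(LINT q:disc R|lborel. 1) = pi * R\<^sup>2"
proof -
  have "measure lborel (cball (0 :: real \<times> real) R) = pi * R\<^sup>2"
    using assms by (simp add: content_cball unit_ball_vol_2 power2_eq_square)
  moreover have "emeasure lborel (cball (0 :: real \<times> real) R) < \<infinity>"
    using emeasure_bounded_finite[OF bounded_cball] by blast
  ultimately show ?thesis
    using assms by (simp add: disc_eq_cball set_integral_const)
qed

text \<open>The recurrence is solved from the area of the disc upwards. The factorial quotient is
  the \<open>m\<close>-th Catalan number, as in the moments of the semicircle law.\<close>

lemma disc_moment_even:
  assumes "R > 0"
  shows "(LINT q:disc R|lborel. fst q ^ (2 * m)) =
    pi * R\<^sup>2 * (fact (2 * m) / (fact m * fact (m + 1)) * (R / 2) ^ (2 * m))"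
proof (induction m)
  case 0
  then show ?case using disc_moment_0[of R] assms by simp
next
  case (Suc m)
  let ?M = "\<lambda>n. LINT q:disc R|lborel. fst q ^ n"
  have "real (2 * m + 4) * ?M (2 * m + 2) = real (2 * m + 1) * R\<^sup>2 * ?M (2 * m)"
    using semicircle_moment_rec[OF assms, of "2 * m"]
    by (simp only: disc_moment_eq_semicircle_moment[OF assms] mult.left_commute[of _ 2])
  then have "?M (2 * Suc m) = real (2 * m + 1) / real (2 * m + 4) * R\<^sup>2 * ?M (2 * m)"
    by (simp add: field_simps)
  also have "\<dots> = pi * R\<^sup>2 * (fact (2 * Suc m) / (fact (Suc m) * fact (Suc m + 1))
      * (R / 2) ^ (2 * Suc m))"
  proof -
    \<comment> \<open>With these factors split off, the closed form grows by
      \<open>(2 * m + 1) / (2 * m + 4) * R\<^sup>2\<close> from \<open>m\<close> to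
      \<open>Suc m\<close>, just as the recurrence demands.\<close>
    have "fact (2 * Suc m) = (real (2 * m + 2) * real (2 * m + 1) * fact (2 * m) :: real)"
      "fact (Suc m) = (real (m + 1) * fact m :: real)"
      "fact (Suc m + 1) = (real (m + 2) * fact (m + 1) :: real)"
      by simp_all
    then show ?thesis
      unfolding Suc.IH by (simp add: divide_simps power2_eq_square del: of_nat_add of_nat_mult fact_Suc)
        (simp add: algebra_simps)
  qed
  finally show ?case .
qed

section \<open>From the cosine series to the Bessel series\<close>

text \<open>Comparison with the series of exp(x^2). It serves both the cosine series at a point and
  the series of its integrated terms.\<close>

lemma summable_even_exp:
  fixes c :: "nat \<Rightarrow> real"
  assumes "\<And>m. norm (c m) \<le> inverse (fact m)"
  shows "summable (\<lambda>m. norm (c m * x ^ (2 * m)))"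
proof (rule summable_comparison_test'[where N = 0])
  show "summable (\<lambda>m. inverse (fact m) * (x\<^sup>2) ^ m)" by (rule summable_exp)
  show "norm (norm (c m * x ^ (2 * m))) \<le> inverse (fact m) * (x\<^sup>2) ^ m" for m
    using mult_right_mono[OF assms[of m], of "(x\<^sup>2) ^ m"]
    by (simp add: abs_mult power_mult)
qed

text \<open>The cosine series is integrated term by term, which absolute convergence permits. The
  factor \<open>fact (2 * m)\<close> in the moment cancels the one in the cosine coefficient and
  leaves the coefficients of \<open>bessel_J 1\<close>.\<close>

lemma disc_integral_cos_sums:
  assumes "R > 0"
  shows "(\<lambda>m. pi * R\<^sup>2 * ((-1) ^ m / (fact m * fact (m + 1)) * (R * s / 2) ^ (2 * m)))
    sums (LINT q:disc R|lborel. cos (s * fst q))"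
proof -
  define t where "t m q = indicator (disc R) q *\<^sub>R ((-1) ^ m / fact (2 * m) * (s * fst q) ^ (2 * m))"
    for m and q :: "real \<times> real"
  \<comment> \<open>The integral of the absolute value of the \<open>m\<close>-th term. The signed
    integral is \<open>(-1) ^ m * a m\<close>, so \<open>moment\<close> is used with
    \<open>c = 1\<close> for convergence and with \<open>c = (-1) ^ m\<close> for the value.\<close>
  define a where "a m = pi * R\<^sup>2 * (1 / (fact m * fact (m + 1)) * (R * s / 2) ^ (2 * m))" for m
  have int: "set_integrable lborel (disc R) (\<lambda>q. c * fst q ^ n)" for c n
    using assms by (intro set_integrable_disc continuous_intros) simp
  have moment: "(LINT q:disc R|lborel. c / fact (2 * m) * (s * fst q) ^ (2 * m)) = c * a m" for c m
    unfolding power_mult_distrib mult.assoc[symmetric]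
    by (simp add: disc_moment_even[OF assms] a_def power_mult_distrib power_divide del: fact_Suc)
      (simp add: mult_ac del: fact_Suc)
  \<comment> \<open>The powers are even, so taking the norm only removes the sign
    \<open>(-1) ^ m\<close>.\<close>
  have norm_t: "norm (t m q) = indicator (disc R) q *\<^sub>R (1 / fact (2 * m) * (s * fst q) ^ (2 * m))" for m q
    by (simp add: t_def power_mult power_mult_distrib abs_mult power_abs)
  have coeff: "norm ((-1) ^ m / fact (2 * m) :: real) \<le> inverse (fact m)" for m
    by (simp add: abs_mult power_abs inverse_eq_divide frac_le fact_mono)
  have coeff': "norm (1 / (fact m * fact (m + 1)) :: real) \<le> inverse (fact m)" for m
    by (simp add: inverse_eq_divide frac_le fact_ge_1 mult_ge1_I del: fact_Suc)
  have "(\<lambda>m. integral\<^sup>L lborel (t m)) sums (LINT q|lborel. (\<Sum>m. t m q))"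
  proof (rule sums_integral)
    show "integrable lborel (t m)" for m
      using int[of "(-1) ^ m / fact (2 * m) * s ^ (2 * m)" "2 * m"]
      by (simp add: t_def[abs_def] set_integrable_def power_mult_distrib mult.assoc)
    show "AE q in lborel. summable (\<lambda>m. norm (t m q))"
    proof (rule AE_I2)
      fix q
      show "summable (\<lambda>m. norm (t m q))"
        using summable_mult[OF summable_even_exp[of "\<lambda>m. (-1) ^ m / fact (2 * m)" "s * fst q", OF coeff],
            of "indicator (disc R) q"]
        by (simp add: t_def abs_mult)
    qed
    have "(LINT q|lborel. norm (t m q)) = a m" for m
      using moment[of 1 m] by (simp only: norm_t set_lebesgue_integral_def mult_1)
    moreover have "summable a"
      unfolding a_def
      by (intro summable_mult summable_norm_cancel[OF summable_even_exp] coeff')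
    ultimately show "summable (\<lambda>m. LINT q|lborel. norm (t m q))" by simp
  qed
  moreover have "(\<Sum>m. t m q) = indicator (disc R) q *\<^sub>R cos (s * fst q)" for q
    using sums_scaleR_right[OF cos_paired, THEN sums_unique] by (simp only: t_def)
  moreover have "integral\<^sup>L lborel (t m) =
      pi * R\<^sup>2 * ((-1) ^ m / (fact m * fact (m + 1)) * (R * s / 2) ^ (2 * m))" for m
  proof -
    have "(-1) ^ m * a m =
        pi * R\<^sup>2 * ((-1) ^ m / (fact m * fact (m + 1)) * (R * s / 2) ^ (2 * m))"
      by (simp add: a_def)
    then show ?thesis
      using moment[of "(-1) ^ m" m] by (simp only: t_def[abs_def] set_lebesgue_integral_def)
  qed
  ultimately show ?thesis by (simp add: set_lebesgue_integral_def)
qed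

text \<open>One factor \<open>R * \<kappa> * c / 2\<close> of the odd power in the Bessel series
  cancels against the prefactor \<open>2 * pi * R / (\<kappa> * c)\<close> and leaves
  \<open>pi * R\<^sup>2\<close> with an even power.\<close>

lemma B_fun_sums:
  assumes "\<kappa> \<noteq> 0"
  shows "(\<lambda>m. pi * R\<^sup>2 * ((-1) ^ m / (fact m * fact (m + 1)) * (R * (\<kappa> * c) / 2) ^ (2 * m)))
    sums B_fun R \<kappa> c"
proof (cases "c = 0")
  case True
  \<comment> \<open>Only the term \<open>m = 0\<close> survives, because \<open>0 ^ 0 = 1\<close>;
    it is the limit value that \<open>B_fun\<close> takes at 0.\<close>
  then show ?thesis
    using sums_If_finite_set[of "{0}" "\<lambda>_. pi * R\<^sup>2"]
    by (simp add: B_fun_def power_0_left if_distrib cong: if_cong)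
next
  case False
  have "(\<lambda>m. 2 * pi * R / (\<kappa> * c) * ((-1) ^ m / (fact m * fact (m + 1)) * (R * \<kappa> * c / 2) ^ (2 * m + 1)))
      sums (2 * pi * R / (\<kappa> * c) * bessel_J 1 (R * \<kappa> * c))"
    by (rule sums_mult[OF bessel_J_sums])
  moreover have "2 * pi * R / (\<kappa> * c) * (d * (R * \<kappa> * c / 2) ^ (2 * m + 1)) =
      pi * R\<^sup>2 * (d * (R * (\<kappa> * c) / 2) ^ (2 * m))" for d m
    using assms False by (simp add: power2_eq_square mult.assoc)
  ultimately show ?thesis
    using False by (simp add: B_fun_def mult.assoc)
qed

section \<open>Fourier transform of the disc\<close>

lemma disc_integral_cos:
  assumes "R > 0" "\<kappa> \<noteq> 0"
  shows "(LINT q:disc R|lborel. cos (\<kappa> * (a * fst q + b * snd q))) =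
    B_fun R \<kappa> (sqrt (a\<^sup>2 + b\<^sup>2))"
proof -
  define c where "c = sqrt (a\<^sup>2 + b\<^sup>2)"
  have c2: "c\<^sup>2 = a\<^sup>2 + b\<^sup>2" by (simp add: c_def)
  have "(LINT q:disc R|lborel. cos (\<kappa> * (a * fst q + b * snd q))) =
      (LINT q:disc R|lborel. cos (\<kappa> * c * fst q))"
  proof (cases "c = 0")
    case True
    then have "a = 0" "b = 0" using c2 by (auto simp: sum_power2_eq_zero_iff)
    then show ?thesis using True by simp
  next
    case False
    \<comment> \<open>The rotation with these parameters has first coordinate
      \<open>(a * fst q + b * snd q) / c\<close>, so the factor \<open>c\<close> restores the
      original phase.\<close>
    have "(a / c)\<^sup>2 + (b / c)\<^sup>2 = 1"
      using False by (simp add: power_divide add_divide_distrib[symmetric] c2[symmetric])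
    moreover have "(\<lambda>q :: real \<times> real. cos (\<kappa> * c * fst q)) \<in> borel_measurable borel"
      by (intro borel_measurable_continuous_onI continuous_intros)
    ultimately have "(LINT q:disc R|lborel. cos (\<kappa> * c * fst (plane_rotation (a / c) (b / c) q))) =
        (LINT q:disc R|lborel. cos (\<kappa> * c * fst q))"
      by (rule set_integral_disc_plane_rotation)
    then show ?thesis using False by (simp add: plane_rotation_def distrib_left mult.assoc)
  qed
  then show ?thesis
    \<comment> \<open>The integral and \<open>B_fun\<close> are sums of literally the same
      series.\<close>
    using sums_unique2[OF disc_integral_cos_sums[OF assms(1), of "\<kappa> * c"] B_fun_sums[OF assms(2)]]
    by (simp add: c_def)
qed

text \<open>The half turn \<open>plane_rotation (-1) 0\<close> maps the disc to itself and flips the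
  sign of the integrand, so the integral equals its own negative.\<close>

lemma disc_integral_sin:
  "(LINT q:disc R|lborel. sin (a * fst q + b * snd q)) = 0"
proof -
  have "(\<lambda>q :: real \<times> real. sin (a * fst q + b * snd q)) \<in> borel_measurable borel"
    by (intro borel_measurable_continuous_onI continuous_intros)
  from set_integral_disc_plane_rotation[of "-1" 0, OF _ this]
  have "(LINT q:disc R|lborel. sin (- (a * fst q + b * snd q))) =
      (LINT q:disc R|lborel. sin (a * fst q + b * snd q))"
    by (simp add: plane_rotation_def)
  then show ?thesis
    unfolding sin_minus by (simp add: set_lebesgue_integral_def)
qed

lemma disc_integral_plane_wave:
  assumes "R > 0" "\<kappa> \<noteq> 0"
  shows "(LINT q:disc R|lborel. cis (\<kappa> * (a * fst q + b * snd q))) =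
    complex_of_real (B_fun R \<kappa> (sqrt (a\<^sup>2 + b\<^sup>2)))"
proof -
  have int: "set_integrable lborel (disc R) (\<lambda>q. cis (\<kappa> * (a * fst q + b * snd q)))"
    using assms by (intro set_integrable_disc continuous_intros) simp
  show ?thesis
  proof (rule complex_eqI)
    show "Re (LINT q:disc R|lborel. cis (\<kappa> * (a * fst q + b * snd q))) =
        Re (complex_of_real (B_fun R \<kappa> (sqrt (a\<^sup>2 + b\<^sup>2))))"
      using integral_Re[OF int[unfolded set_integrable_def]] disc_integral_cos[OF assms, of a b]
      by (simp add: set_lebesgue_integral_def)
    show "Im (LINT q:disc R|lborel. cis (\<kappa> * (a * fst q + b * snd q))) =
        Im (complex_of_real (B_fun R \<kappa> (sqrt (a\<^sup>2 + b\<^sup>2))))"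
      using integral_Im[OF int[unfolded set_integrable_def]] disc_integral_sin[of R "\<kappa> * a" "\<kappa> * b"]
      by (simp add: set_lebesgue_integral_def distrib_left mult.assoc)
  qed
qed

section \<open>Effective channel and spectral efficiency\<close>

text \<open>The phase difference of the two responses splits into a part independent of position,
  which leaves the integral as a unit factor, and a plane wave.\<close>

lemma effective_channel_disc:
  assumes "R > 0" "\<kappa> \<noteq> 0"
  shows "effective_channel (disc R) \<kappa> v w =
    cis (\<kappa> * (centre_dist v - centre_dist w) + phase v - phase w)
      * complex_of_real (B_fun R \<kappa> (chi v w))"
proof -
  define \<theta> where "\<theta> = \<kappa> * (centre_dist v - centre_dist w) + phase v - phase w"
  have response: "channel_response \<kappa> v x y =
      cis (- (\<kappa> * centre_dist v + \<kappa> * ((ypos v * y - xpos v * x) / centre_dist v) + phase v))"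
    for v x y
    unfolding channel_response_def cis_conv_exp
    by (simp only: of_real_minus mult_minus_left mult_minus_right)
  \<comment> \<open>The wave vector is \<open>\<kappa>\<close> times
    \<open>(- eta v w, xi v w)\<close>. The minus sign comes from the term
    \<open>- xpos v * x\<close> of the response and disappears in \<open>chi\<close>, where
    \<open>eta\<close> is squared.\<close>
  have "cnj (channel_response \<kappa> v x y) * channel_response \<kappa> w x y =
      cis \<theta> * cis (\<kappa> * (- eta v w * x + xi v w * y))" for x y
    unfolding response cis_cnj cis_mult \<theta>_def
    by (rule arg_cong[where f = cis])
      (simp add: eta_def xi_def algebra_simps diff_divide_distrib)
  then have "effective_channel (disc R) \<kappa> v w =
      (LINT q:disc R|lborel. cis \<theta> * cis (\<kappa> * (- eta v w * fst q + xi v w * snd q)))"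
    by (simp only: effective_channel_def case_prod_unfold)
  also have "\<dots> = cis \<theta> * complex_of_real (B_fun R \<kappa> (chi v w))"
    by (simp only: set_integral_mult_right disc_integral_plane_wave[OF assms] chi_def power2_minus)
  finally show ?thesis by (simp only: \<theta>_def)
qed

text \<open>Interference sees only the modulus of the effective channel, so the unit phase drops
  out. The squared area \<open>A\<^sup>2\<close> is then common to numerator and
  denominator.\<close>

lemma spectral_efficiency_disc:
  assumes "R > 0" "\<kappa> \<noteq> 0"
  shows "spectral_efficiency (disc R) \<kappa> \<sigma> K u k =
    log 2 (1 + tx_power (u k) * path_loss \<kappa> (u k) /
      (1 / (pi * R\<^sup>2) * \<sigma>\<^sup>2 +
       (\<Sum>k'\<in>{1..K} - {k}. tx_power (u k') * path_loss \<kappa> (u k') *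
          (B_normalized R \<kappa> (u k) (u k'))\<^sup>2)))"
proof -
  define A where "A = pi * R\<^sup>2"
  have A: "A > 0" using assms by (simp add: A_def)
  \<comment> \<open>\<open>chi v v\<close> is 0, so \<open>B_fun\<close> is in its limit
    branch.\<close>
  have self: "B_fun R \<kappa> (chi v v) = A" for v
    by (simp add: A_def B_fun_def chi_def eta_def xi_def)
  let ?p = "\<lambda>k. tx_power (u k) * path_loss \<kappa> (u k)"
  let ?D = "1 / A * \<sigma>\<^sup>2 + (\<Sum>k'\<in>{1..K} - {k}. ?p k' * (B_normalized R \<kappa> (u k) (u k'))\<^sup>2)"
  have "effective_channel (disc R) \<kappa> v v = complex_of_real A" for v
    by (simp add: effective_channel_disc[OF assms] self)
  moreover have "cmod (effective_channel (disc R) \<kappa> v w) = A * \<bar>B_normalized R \<kappa> v w\<bar>" for v w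
    using A by (simp add: effective_channel_disc[OF assms] norm_mult B_normalized_def self)
  ultimately have "spectral_efficiency (disc R) \<kappa> \<sigma> K u k = log 2 (1 + ?p k * A\<^sup>2 /
      (A * \<sigma>\<^sup>2 + (\<Sum>k'\<in>{1..K} - {k}. ?p k' * (A * \<bar>B_normalized R \<kappa> (u k) (u k')\<bar>)\<^sup>2)))"
    by (simp add: spectral_efficiency_def)
  \<comment> \<open>The noise carries only one factor \<open>A\<close>, hence the
    \<open>1 / A\<close> in \<open>?D\<close>; each interference term carries two.\<close>
  moreover have "A * \<sigma>\<^sup>2 + (\<Sum>k'\<in>{1..K} - {k}. ?p k' * (A * \<bar>B_normalized R \<kappa> (u k) (u k')\<bar>)\<^sup>2) = A\<^sup>2 * ?D"
    using A by (simp add: distrib_left sum_distrib_left power_mult_distrib mult_ac power2_eq_square[of A])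
  ultimately show ?thesis using A by (simp add: A_def[symmetric])
qed

theorem proposition3:
  fixes R wl \<kappa> \<sigma> :: real and K :: nat and u :: "nat \<Rightarrow> user"
  assumes "R > 0" and "wl > 0" and "\<kappa> = wavenumber wl" and "\<sigma>\<^sup>2 > 0"
    and "\<And>k. k \<in> {1..K} \<Longrightarrow> zpos (u k) > 0"
    and "\<And>k. k \<in> {1..K} \<Longrightarrow> tx_power (u k) \<ge> 0"
    and "\<And>k. k \<in> {1..K} \<Longrightarrow> phase (u k) \<in> {-pi..pi}"
  shows "(\<forall>k\<in>{1..K}. spectral_efficiency (disc R) \<kappa> \<sigma> K u k =
            log 2 (1 + tx_power (u k) * path_loss \<kappa> (u k) /
              (1 / (pi * R\<^sup>2) * \<sigma>\<^sup>2 +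
               (\<Sum>k'\<in>{1..K} - {k}. tx_power (u k') * path_loss \<kappa> (u k') *
                  (B_normalized R \<kappa> (u k) (u k'))\<^sup>2))))
       \<and> sum_spectral_efficiency (disc R) \<kappa> \<sigma> K u =
            (\<Sum>k=1..K. log 2 (1 + tx_power (u k) * path_loss \<kappa> (u k) /
              (1 / (pi * R\<^sup>2) * \<sigma>\<^sup>2 +
               (\<Sum>k'\<in>{1..K} - {k}. tx_power (u k') * path_loss \<kappa> (u k') *
                  (B_normalized R \<kappa> (u k) (u k'))\<^sup>2))))"
proof -
  \<comment> \<open>A positive wavelength gives a nonzero wavenumber, so \<open>B_fun\<close>
    divides by 0 only in its separate case \<open>c = 0\<close>.\<close>
  have "\<kappa> \<noteq> 0" using assms(2,3) by (simp add: wavenumber_def)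
  note eff = spectral_efficiency_disc[OF assms(1) this]
  show ?thesis unfolding sum_spectral_efficiency_def eff by simp
qed

end
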